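(* Let $n,k$ be positive integers with $k\le n$ and let $\mathcal{A}\subset\binom{[n]}{k}$ be nonempty. Then $$\mathsf{e}(\mathcal{A})\ \leq\ n\cdot\ell'\cdot|\mathcal{A}|,$$ where $$\ell'=\min\left\{\left\lceil\frac{\log|\mathcal{A}|}{\log n-\log\log|\mathcal{A}|}\right\rceil,\ \lfloor\log|\mathcal{A}|\rfloor\right\}.$$
   Context: All logarithms $\log$ are base two. $[n]=\{1,\dots,n\}$ and $\binom{[n]}{k}$ is the set of all $k$-element subsets of $[n]$; $\mathcal{A}$ may be all of $\binom{[n]}{k}$. The Kleitman-West graph is the graph with vertex set $\binom{[n]}{k}$ in which two $k$-element sets are adjacent if and only if their symmetric difference has size two. $\mathsf{e}(\mathcal{A})$ is the number of edges of this graph with both endpoints in $\mathcal{A}$. Convention: if $|\mathcal{A}|=1$ then $\ell'=0$. *)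

theory Defs
  imports Complex_Main "HOL-Library.Ramsey"
begin

text \<open>
  \<^const>\<open>nsets\<close> \<open>{1..n}\<close> \<open>k\<close> is the set of all \<open>k\<close>-element subsets of \<open>[n]\<close>.
  An (undirected) edge is the two-element set of its endpoints.
\<close>

definition kw_edges :: "nat \<Rightarrow> nat \<Rightarrow> nat set set set" where
  "kw_edges n k = {{X, Y} | X Y. X \<in> nsets {1..n} k \<and> Y \<in> nsets {1..n} k
                               \<and> card (sym_diff X Y) = 2}"

definition edges_within :: "nat \<Rightarrow> nat \<Rightarrow> nat set set \<Rightarrow> nat" where
  "edges_within n k \<A> = card {E \<in> kw_edges n k. E \<subseteq> \<A>}"

text \<open>
  The argument \<open>m\<close> is the size of the family. The case \<open>m = 1\<close> is a convention, as
  \<open>log 2 (log 2 1)\<close> is undefined. For \<open>2 \<le> m \<le> n choose k\<close> with \<open>k \<ge> 1\<close>, one has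
  \<open>1 \<le> log 2 m < n\<close>, so all logarithms have positive arguments and the denominator is positive.
\<close>

definition ell' :: "nat \<Rightarrow> nat \<Rightarrow> int" where
  "ell' n m = (if m = 1 then 0
     else min \<lceil>log 2 (real m) / (log 2 (real n) - log 2 (log 2 (real m)))\<rceil>
              \<lfloor>log 2 (real m)\<rfloor>)"

end

theory Submission
  imports Defs "HOL-Analysis.Convex"
begin

text \<open>
  Only one feature of the Kleitman-West graph matters: the symmetric difference of two adjacent
  sets has size two, so an edge at a given set that changes the coordinate \<open>i\<close> is determined by
  the second coordinate that it changes. The estimates therefore concern an arbitrary finite
  family \<open>F\<close> of sets and the number \<open>e(F)\<close> of pairs of its members at this distance.

  Split \<open>F\<close> by membership of a coordinate \<open>i\<close>, with \<open>b\<close> members in the smaller part. The value of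
  \<open>x log x\<close> at \<open>|F|\<close> exceeds the sum of its values at the sizes of the two parts by at least
  \<open>b + b log (|F| / b)\<close>, the gain of the split. If the edges that cross the split never exceed a fixed multiple of that
  gain, summing over a full decomposition bounds all edges by the same multiple of
  \<open>|F| log |F|\<close> (lemma \<open>splitting_principle\<close>). It remains to find good coordinates.

  Each member of the smaller part has at most one crossing edge for each coordinate that varies in
  \<open>F\<close>, so at most \<open>n b\<close> edges cross. As \<open>|F| / b \<ge> 2\<close>, the gain is at least \<open>2 b\<close>. So any
  varying coordinate may be split, which gives \<open>e(F) \<le> n |F| log |F| / 2\<close> (lemma \<open>card_adj_pairs_le\<close>). This is at
  most \<open>n |F| \<lfloor>log |F|\<rfloor>\<close>.

  The other bound is \<open>e(F) \<le> n |F| log |F| / log R\<close> with \<open>R = n / log |F|\<close>. Here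
  \<open>R > 1\<close>, because a family of nonempty subsets of \<open>[n]\<close> has fewer than \<open>2 ^ n\<close> members. For
  \<open>R \<le> 4\<close> the first bound already suffices. For \<open>R \<ge> 4\<close> let \<open>G\<close> be a subfamily met in the decomposition.
  By the first bound, applied with the number of varying coordinates of \<open>G\<close> in place of \<open>n\<close>, an
  average varying coordinate is crossed by at most \<open>|G| log |G|\<close> edges, so some coordinate is
  crossed by at most that many (lemma \<open>sparse_coordinate\<close>). It may be split:
  if \<open>|G| / b \<ge> R\<close>, the gain \<open>b log (|G| / b)\<close> is at least \<open>b log R\<close>, which pays for \<open>n b\<close>
  crossing edges; otherwise \<open>b\<close> is large, and since \<open>(log x) / x\<close> is at least \<open>(log R) / R\<close> on
  \<open>[2, R]\<close>, the gain pays for \<open>|G| log |G|\<close> crossing edges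
  (lemma \<open>card_adj_pairs_le_small_family\<close>).
\<close>

section \<open>The function \<open>x log x\<close>\<close>

definition xlog2 :: "real \<Rightarrow> real" where
  "xlog2 x = x * log 2 x"

lemma log2_above_chord:
  fixes u :: real
  assumes "0 \<le> u" "u \<le> 1"
  shows "u \<le> log 2 (1 + u)"
proof -
  have "concave_on {0<..} (\<lambda>x::real. log 2 x)"
    by (rule log_concave) simp_all
  then have "(1 - u) * log 2 1 + u * log 2 2 \<le> log 2 ((1 - u) *\<^sub>R 1 + u *\<^sub>R 2)"
    using assms by (intro concave_onD) auto
  also have "(1 - u) *\<^sub>R 1 + u *\<^sub>R 2 = 1 + u"
    by simp
  finally show ?thesis
    by simp
qed

text \<open>
  Up to the factor \<open>a + b\<close> the right-hand side is the binary entropy of \<open>b / (a + b)\<close>. The smaller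
  part contributes \<open>b log ((a + b) / b)\<close>; the larger one contributes \<open>a log (1 + b / a)\<close>, which is
  at least \<open>b\<close> because the concave function \<open>log (1 + u)\<close> lies above its chord on \<open>[0, 1]\<close>.
\<close>

lemma xlog2_gain:
  assumes "0 < b" "b \<le> a"
  shows "b + b * log 2 ((a + b) / b) \<le> xlog2 (a + b) - xlog2 a - xlog2 b"
proof -
  have "b / a \<le> log 2 (1 + b / a)"
    using assms by (intro log2_above_chord) auto
  also have "1 + b / a = (a + b) / a"
    using assms by (simp add: field_simps)
  finally have "b \<le> a * log 2 ((a + b) / a)"
    using assms by (simp add: field_simps)
  also have "a * log 2 ((a + b) / a) = a * log 2 (a + b) - a * log 2 a"
    using assms by (simp add: log_divide algebra_simps)
  finally have "b \<le> a * log 2 (a + b) - a * log 2 a" .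
  moreover have "b * log 2 ((a + b) / b) = b * log 2 (a + b) - b * log 2 b"
    using assms by (simp add: log_divide algebra_simps)
  ultimately show ?thesis
    by (simp add: xlog2_def algebra_simps)
qed

lemma log2_ratio_ge:
  assumes "0 < b" "b \<le> a"
  shows "1 \<le> log 2 ((a + b) / b)"
proof -
  have "2 \<le> (a + b) / b"
    using assms by (simp add: field_simps)
  then show ?thesis
    by simp
qed

text \<open>
  The function \<open>(log x) / x\<close> decreases only from \<open>exp 1\<close> on. The inequality still reaches down to
  \<open>x = 2\<close>, since the values at \<open>2\<close> and \<open>4\<close> are both \<open>1 / 2\<close> and by concavity of the logarithm
  no value in between is smaller. This is where \<open>4 \<le> R\<close> comes from.
\<close>

lemma log2_ratio_mono:
  fixes x R :: real
  assumes "2 \<le> x" "x \<le> R" "4 \<le> R"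
  shows "x * log 2 R \<le> R * log 2 x"
proof -
  have decreasing: "y * ln R \<le> R * ln y" if y: "4 \<le> y" "y \<le> R" for y :: real
  proof -
    have "exp 1 \<le> y"
      using exp_le y by linarith
    then have "1 \<le> ln y"
      using y by (subst ln_ge_iff) auto
    have "ln R = ln y + ln (R / y)"
      using y by (simp add: ln_div)
    also have "ln (R / y) \<le> R / y - 1"
      using y by (intro ln_le_minus_one) auto
    also have "R / y - 1 \<le> (R / y - 1) * ln y"
      using y \<open>1 \<le> ln y\<close> by (simp add: mult_le_cancel_left1)
    finally show ?thesis
      using y by (simp add: field_simps)
  qed
  show ?thesis
  proof (cases "4 \<le> x")
    case True
    then show ?thesis
      using decreasing[of x] assms by (simp add: log_def field_simps)
  next
    case False
    have "(x - 2) / 2 \<le> log 2 (1 + (x - 2) / 2)"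
      using False assms by (intro log2_above_chord) auto
    also have "1 + (x - 2) / 2 = x / 2"
      by (simp add: field_simps)
    also have "log 2 (x / 2) = log 2 x - 1"
      using assms by (simp add: log_divide)
    finally have x: "x \<le> 2 * log 2 x"
      by simp
    have "4 * ln R \<le> R * ln (2 ^ 2)"
      using decreasing[of 4] assms by simp
    then have "4 * ln R \<le> R * (2 * ln 2)"
      by (subst (asm) ln_realpow) auto
    then have R: "2 * log 2 R \<le> R"
      by (simp add: log_def field_simps)
    have "x * log 2 R \<le> (2 * log 2 x) * log 2 R"
      using x assms by (intro mult_right_mono) auto
    also have "\<dots> = (2 * log 2 R) * log 2 x"
      by simp
    also have "\<dots> \<le> R * log 2 x"
      using R assms by (intro mult_right_mono) auto
    finally show ?thesis .
  qed
qed

section \<open>Splitting a family at a coordinate\<close>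

text \<open>Pairs are ordered, so every edge is counted twice here and in \<open>cross_pairs\<close>.\<close>

definition adj_pairs :: "'a set set \<Rightarrow> ('a set \<times> 'a set) set" where
  "adj_pairs F = {(X, Y). X \<in> F \<and> Y \<in> F \<and> card (sym_diff X Y) = 2}"

definition cross_pairs :: "'a \<Rightarrow> 'a set set \<Rightarrow> ('a set \<times> 'a set) set" where
  "cross_pairs i F = {(X, Y) \<in> adj_pairs F. i \<in> sym_diff X Y}"

definition containing :: "'a \<Rightarrow> 'a set set \<Rightarrow> 'a set set" where
  "containing i F = {X \<in> F. i \<in> X}"

definition avoiding :: "'a \<Rightarrow> 'a set set \<Rightarrow> 'a set set" where
  "avoiding i F = {X \<in> F. i \<notin> X}"

definition varying :: "'a set set \<Rightarrow> 'a set" where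
  "varying F = (\<Union>X\<in>F. \<Union>Y\<in>F. sym_diff X Y)"

lemma finite_adj_pairs [simp]: "finite F \<Longrightarrow> finite (adj_pairs F)"
  by (rule finite_subset[of _ "F \<times> F"]) (auto simp: adj_pairs_def)

lemma finite_cross_pairs [simp]: "finite F \<Longrightarrow> finite (cross_pairs i F)"
  by (rule finite_subset[of _ "adj_pairs F"]) (auto simp: cross_pairs_def)

lemma finite_parts [simp]:
  assumes "finite F"
  shows "finite (containing i F)" "finite (avoiding i F)"
  using assms by (auto simp: containing_def avoiding_def)

lemma card_parts:
  assumes "finite F"
  shows "card F = card (containing i F) + card (avoiding i F)"
proof -
  have "F = containing i F \<union> avoiding i F"
    by (auto simp: containing_def avoiding_def)
  moreover have "card \<dots> = card (containing i F) + card (avoiding i F)"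
    using assms by (intro card_Un_disjoint) (auto simp: containing_def avoiding_def)
  ultimately show ?thesis
    by simp
qed

lemma parts_nonempty:
  assumes "i \<in> varying F"
  shows "containing i F \<noteq> {}" "avoiding i F \<noteq> {}"
  using assms by (auto simp: varying_def containing_def avoiding_def)

lemma varying_nonempty:
  assumes "2 \<le> card F"
  shows "varying F \<noteq> {}"
proof -
  have "finite F"
    using assms card.infinite by fastforce
  then obtain X Y where "X \<in> F" "Y \<in> F" "X \<noteq> Y"
    using assms card_le_Suc0_iff_eq[of F] by auto
  then show ?thesis
    by (auto simp: varying_def)
qed

lemma varying_mono: "G \<subseteq> F \<Longrightarrow> varying G \<subseteq> varying F"
  by (auto simp: varying_def)

lemma card_adj_pairs_split:
  assumes "finite F"
  shows "card (adj_pairs F) =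
    card (adj_pairs (containing i F)) + card (adj_pairs (avoiding i F)) + card (cross_pairs i F)"
proof -
  have "adj_pairs F = (adj_pairs (containing i F) \<union> adj_pairs (avoiding i F)) \<union> cross_pairs i F"
    by (auto simp: adj_pairs_def cross_pairs_def containing_def avoiding_def)
  moreover have "adj_pairs (containing i F) \<inter> adj_pairs (avoiding i F) = {}"
    "(adj_pairs (containing i F) \<union> adj_pairs (avoiding i F)) \<inter> cross_pairs i F = {}"
    by (auto simp: adj_pairs_def cross_pairs_def containing_def avoiding_def)
  ultimately show ?thesis
    using assms by (simp add: card_Un_disjoint)
qed

text \<open>
  A crossing pair is determined by its member in \<open>M\<close>, the other coordinate \<open>j\<close> in which the two
  sets differ, and the order of the pair; the factor \<open>2\<close> accounts for the order. Both parts of the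
  split can serve as \<open>M\<close>, which yields the minimum in \<open>card_cross_pairs_le\<close>.
\<close>

lemma card_cross_pairs_part:
  fixes F :: "'a set set"
  assumes fin: "finite F" "finite (varying F)" and "M \<subseteq> F"
    and separates: "\<And>X Y. (X, Y) \<in> cross_pairs i F \<Longrightarrow> X \<in> M \<or> Y \<in> M"
  shows "card (cross_pairs i F) \<le> 2 * (card (varying F) * card M)"
proof -
  define P where "P = (\<lambda>(X, j). (X, sym_diff X {i, j})) ` (M \<times> varying F)"
  have finM: "finite M"
    using assms finite_subset by blast
  have pair: "\<exists>j. D = {i, j}" if "card D = 2" "i \<in> D" for D :: "'a set"
    using that by (auto simp: card_2_iff)
  have mem: "(X, Y) \<in> P" if "(X, Y) \<in> cross_pairs i F" "X \<in> M" for X Y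
  proof -
    have "card (sym_diff X Y) = 2" "i \<in> sym_diff X Y"
      using that by (auto simp: cross_pairs_def adj_pairs_def)
    then obtain j where "sym_diff X Y = {i, j}"
      using pair by blast
    moreover from this have "Y = sym_diff X {i, j}"
      by blast
    moreover have "j \<in> varying F"
      using that calculation unfolding varying_def cross_pairs_def adj_pairs_def by blast
    ultimately show ?thesis
      using that by (auto simp: P_def)
  qed
  have "cross_pairs i F \<subseteq> P \<union> prod.swap ` P"
  proof (rule subrelI)
    fix X Y assume XY: "(X, Y) \<in> cross_pairs i F"
    then have YX: "(Y, X) \<in> cross_pairs i F"
      by (auto simp: cross_pairs_def adj_pairs_def Un_commute)
    show "(X, Y) \<in> P \<union> prod.swap ` P"
      using separates[OF XY] mem[OF XY] mem[OF YX] by force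
  qed
  moreover have "finite P"
    using finM fin by (simp add: P_def)
  ultimately have "card (cross_pairs i F) \<le> card (P \<union> prod.swap ` P)"
    by (intro card_mono) auto
  also have "\<dots> \<le> card P + card P"
    using card_Un_le[of P "prod.swap ` P"] card_image_le[OF \<open>finite P\<close>, of prod.swap] by linarith
  also have "card P \<le> card (varying F) * card M"
    unfolding P_def using finM fin card_image_le[of "M \<times> varying F"]
    by (simp add: card_cartesian_product mult.commute)
  finally show ?thesis
    by simp
qed

lemma card_cross_pairs_le:
  assumes "finite F" "finite (varying F)"
  shows "card (cross_pairs i F)
    \<le> 2 * (card (varying F) * min (card (containing i F)) (card (avoiding i F)))"
proof -
  have "card (cross_pairs i F) \<le> 2 * (card (varying F) * card (containing i F))"
    by (rule card_cross_pairs_part[OF assms])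
      (auto simp: containing_def cross_pairs_def adj_pairs_def)
  moreover have "card (cross_pairs i F) \<le> 2 * (card (varying F) * card (avoiding i F))"
    by (rule card_cross_pairs_part[OF assms])
      (auto simp: avoiding_def cross_pairs_def adj_pairs_def)
  ultimately show ?thesis
    by (simp add: min_def)
qed

text \<open>Every adjacent pair crosses the splits at exactly two coordinates.\<close>

lemma sum_card_cross_pairs:
  assumes "finite F" "finite (varying F)"
  shows "(\<Sum>i\<in>varying F. card (cross_pairs i F)) = 2 * card (adj_pairs F)"
proof -
  have "(\<Sum>i\<in>varying F. card {p \<in> adj_pairs F. i \<in> sym_diff (fst p) (snd p)})
      = 2 * card (adj_pairs F)"
  proof (rule sum_multicount[OF assms(2) finite_adj_pairs[OF assms(1)]], safe)
    fix X Y assume XY: "(X, Y) \<in> adj_pairs F"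
    then have "{i \<in> varying F. i \<in> sym_diff X Y} = sym_diff X Y"
      by (auto simp: varying_def adj_pairs_def)
    then show "card {i \<in> varying F. i \<in> sym_diff (fst (X, Y)) (snd (X, Y))} = 2"
      using XY by (simp add: adj_pairs_def)
  qed
  moreover have "{p \<in> adj_pairs F. i \<in> sym_diff (fst p) (snd p)} = cross_pairs i F" for i
    by (auto simp: cross_pairs_def)
  ultimately show ?thesis
    by simp
qed

text \<open>
  Adjacent pairs are either inside one part or crossing, and the hypothesis charges the crossing
  ones to the increase of \<open>xlog2\<close>; the increases telescope along the decomposition into singletons.
  The coordinate may depend on the subfamily. Requiring it to be varying makes both parts proper.
\<close>

lemma splitting_principle:
  fixes c :: real
  assumes "finite F"
    and split: "\<And>G. \<lbrakk>G \<subseteq> F; 2 \<le> card G\<rbrakk> \<Longrightarrow> \<exists>i\<in>varying G.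
      card (cross_pairs i G)
        \<le> c * (xlog2 (card G) - xlog2 (card (containing i G)) - xlog2 (card (avoiding i G)))"
  shows "card (adj_pairs F) \<le> c * xlog2 (card F)"
proof -
  have "card (adj_pairs G) \<le> c * xlog2 (card G)" if "G \<subseteq> F" for G
    using that
  proof (induction "card G" arbitrary: G rule: less_induct)
    case less
    have fin: "finite G"
      using less.prems assms finite_subset by blast
    show ?case
    proof (cases "2 \<le> card G")
      case False
      have "X = Y" if "X \<in> G" "Y \<in> G" for X Y
        using False fin that card_le_Suc0_iff_eq[of G] by auto
      then have "adj_pairs G = {}"
        by (force simp: adj_pairs_def)
      moreover have "card G = 0 \<or> card G = 1"
        using False by linarith
      ultimately show ?thesis
        by (auto simp: xlog2_def)
    next
      case True
      then obtain i where i: "i \<in> varying G" and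
        cross: "card (cross_pairs i G)
          \<le> c * (xlog2 (card G) - xlog2 (card (containing i G)) - xlog2 (card (avoiding i G)))"
        using split less.prems by blast
      have "0 < card (containing i G)" "0 < card (avoiding i G)"
        using parts_nonempty[OF i] fin by (simp_all add: card_gt_0_iff)
      then have "card (containing i G) < card G" "card (avoiding i G) < card G"
        using card_parts[OF fin, of i] by linarith+
      moreover have "containing i G \<subseteq> F" "avoiding i G \<subseteq> F"
        using less.prems by (auto simp: containing_def avoiding_def)
      ultimately have "card (adj_pairs (containing i G)) \<le> c * xlog2 (card (containing i G))"
        "card (adj_pairs (avoiding i G)) \<le> c * xlog2 (card (avoiding i G))"
        using less.hyps by blast+
      then show ?thesis
        using cross card_adj_pairs_split[OF fin, of i] by (simp add: algebra_simps)
    qed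
  qed
  then show ?thesis
    by simp
qed

lemma parts_gain:
  fixes b :: real
  assumes "finite F" "i \<in> varying F"
  defines "b \<equiv> min (card (containing i F)) (card (avoiding i F))"
  shows "0 < b" "2 * b \<le> card F"
    and "b + b * log 2 (card F / b)
      \<le> xlog2 (card F) - xlog2 (card (containing i F)) - xlog2 (card (avoiding i F))"
proof -
  have pos: "0 < card (containing i F)" "0 < card (avoiding i F)"
    using parts_nonempty[OF assms(2)] assms(1) by (simp_all add: card_gt_0_iff)
  then show "0 < b" "2 * b \<le> card F"
    using card_parts[OF assms(1), of i] by (auto simp: b_def min_def)
  show "b + b * log 2 (card F / b)
      \<le> xlog2 (card F) - xlog2 (card (containing i F)) - xlog2 (card (avoiding i F))"
  proof (cases "card (containing i F) \<le> card (avoiding i F)")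
    case True
    then show ?thesis
      using xlog2_gain[of "card (containing i F)" "card (avoiding i F)"] pos
        card_parts[OF assms(1), of i]
      by (simp add: b_def min_def algebra_simps)
  next
    case False
    then show ?thesis
      using xlog2_gain[of "card (avoiding i F)" "card (containing i F)"] pos
        card_parts[OF assms(1), of i]
      by (simp add: b_def min_def algebra_simps)
  qed
qed

section \<open>Two bounds on the number of adjacent pairs\<close>

text \<open>
  Any varying coordinate \<open>i\<close> works: the gain is at least \<open>2 * b\<close> and each of the \<open>b\<close> members of the
  smaller part lies in at most \<open>2 * card (varying F)\<close> crossing ordered pairs. The factor is the
  number of varying coordinates rather than the size of a ground set, so that averaging over the
  varying coordinates in \<open>sparse_coordinate\<close> cancels it.
\<close>

lemma card_adj_pairs_le:
  assumes "finite F" "finite (varying F)"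
  shows "card (adj_pairs F) \<le> card (varying F) * xlog2 (card F)"
proof (rule splitting_principle[OF assms(1)])
  fix G assume G: "G \<subseteq> F" "2 \<le> card G"
  have fin: "finite G" "finite (varying G)"
    using finite_subset[OF G(1)] finite_subset[OF varying_mono[OF G(1)]] assms by auto
  obtain i where i: "i \<in> varying G"
    using varying_nonempty G by blast
  define b where "b = real (min (card (containing i G)) (card (avoiding i G)))"
  note gain = parts_gain[OF fin(1) i, folded b_def]
  have "1 \<le> log 2 (card G / b)"
    using log2_ratio_ge[of b "card G - b"] gain(1,2) by simp
  then have "b * 1 \<le> b * log 2 (card G / b)"
    using gain(1) by (intro mult_left_mono) auto
  then have gain2: "2 * b
      \<le> xlog2 (card G) - xlog2 (card (containing i G)) - xlog2 (card (avoiding i G))"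
    using gain(3) by linarith
  have "real (card (cross_pairs i G)) \<le> real (card (varying G)) * (2 * b)"
    using card_cross_pairs_le[OF fin, of i, THEN of_nat_mono[where 'a = real]]
    by (simp add: b_def algebra_simps)
  also have "\<dots> \<le> card (varying F) * (2 * b)"
    using gain(1) card_mono[OF assms(2) varying_mono[OF G(1)]] by (intro mult_right_mono) auto
  also have "\<dots> \<le> card (varying F) *
      (xlog2 (card G) - xlog2 (card (containing i G)) - xlog2 (card (avoiding i G)))"
    using gain2 by (intro mult_left_mono) auto
  finally show "\<exists>i\<in>varying G. card (cross_pairs i G) \<le> card (varying F) *
      (xlog2 (card G) - xlog2 (card (containing i G)) - xlog2 (card (avoiding i G)))"
    using i by blast
qed

lemma sparse_coordinate:
  assumes "finite F" "finite (varying F)" "2 \<le> card F"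
  obtains i where "i \<in> varying F" "card (cross_pairs i F) \<le> 2 * xlog2 (card F)"
proof -
  have "\<exists>i\<in>varying F. card (cross_pairs i F) \<le> 2 * xlog2 (card F)"
  proof (rule ccontr)
    assume "\<not> ?thesis"
    then have "(\<Sum>i\<in>varying F. 2 * xlog2 (card F)) < (\<Sum>i\<in>varying F. real (card (cross_pairs i F)))"
      using varying_nonempty[OF assms(3)] assms(2) by (intro sum_strict_mono) auto
    also have "\<dots> = 2 * real (card (adj_pairs F))"
      using sum_card_cross_pairs[OF assms(1,2)]
      by (metis of_nat_mult of_nat_numeral of_nat_sum)
    finally show False
      using card_adj_pairs_le[OF assms(1,2)] by simp
  qed
  then show ?thesis
    using that by blast
qed

text \<open>
  The parameters \<open>N\<close> and \<open>R\<close> stay fixed while the family is decomposed, which is why they are tied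
  to \<open>F\<close> only by inequalities that subfamilies inherit. At a sparse coordinate there are two
  bounds on the crossing pairs, \<open>2 * b * N\<close> and \<open>2 * xlog2 (card G)\<close>; the first is used for an
  unbalanced split and the second for a balanced one.
\<close>

lemma card_adj_pairs_le_small_family:
  fixes N R :: real
  assumes fin: "finite F" "finite (varying F)"
    and N: "card (varying F) \<le> N" and R: "4 \<le> R" "R * log 2 (card F) \<le> N"
  shows "card (adj_pairs F) \<le> 2 * N / log 2 R * xlog2 (card F)"
proof (rule splitting_principle[OF fin(1)])
  fix G assume G: "G \<subseteq> F" "2 \<le> card G"
  have finG: "finite G" "finite (varying G)"
    using finite_subset[OF G(1)] finite_subset[OF varying_mono[OF G(1)]] fin by auto
  obtain i where i: "i \<in> varying G" and sparse: "card (cross_pairs i G) \<le> 2 * xlog2 (card G)"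
    by (rule sparse_coordinate[OF finG G(2)])
  define b where "b = real (min (card (containing i G)) (card (avoiding i G)))"
  note gain = parts_gain[OF finG(1) i, folded b_def]
  have K: "0 < log 2 R"
    using R by simp
  have "0 \<le> N"
    using N by linarith
  have "card (cross_pairs i G) \<le> 2 * N / log 2 R * (b * log 2 (card G / b))"
  proof (cases "R \<le> card G / b")
    case True
    have "card (varying G) \<le> N"
      using N card_mono[OF fin(2) varying_mono[OF G(1)]] by linarith
    have "real (card (cross_pairs i G)) \<le> 2 * b * real (card (varying G))"
      using card_cross_pairs_le[OF finG, of i, THEN of_nat_mono[where 'a = real]]
      by (simp add: b_def algebra_simps)
    also have "\<dots> \<le> 2 * b * N"
      using \<open>card (varying G) \<le> N\<close> gain(1) by (intro mult_left_mono) auto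
    also have "\<dots> = 2 * N / log 2 R * (b * log 2 R)"
      using K by simp
    also have "\<dots> \<le> 2 * N / log 2 R * (b * log 2 (card G / b))"
      using True R gain(1) K \<open>0 \<le> N\<close> by (intro mult_left_mono) auto
    finally show ?thesis .
  next
    case False
    have "log 2 (card G) \<le> log 2 (card F)"
      using G card_mono[OF fin(1) G(1)] by simp
    then have "R * log 2 (card G) \<le> N"
      using R mult_left_mono[of "log 2 (card G)" "log 2 (card F)" R] by linarith
    then have "log 2 (card G) \<le> N / R"
      using R by (simp add: field_simps)
    have "card G / b * log 2 R \<le> R * log 2 (card G / b)"
      using False R gain(1,2) by (intro log2_ratio_mono) (auto simp: field_simps)
    then have ratio: "card G / R \<le> b * log 2 (card G / b) / log 2 R"
      using gain(1) K R by (simp add: field_simps)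
    have "card (cross_pairs i G) \<le> 2 * (card G * log 2 (card G))"
      using sparse by (simp add: xlog2_def)
    also have "\<dots> \<le> 2 * (card G * (N / R))"
      using \<open>log 2 (card G) \<le> N / R\<close> by (intro mult_left_mono) auto
    also have "\<dots> = 2 * N * (card G / R)"
      by simp
    also have "\<dots> \<le> 2 * N * (b * log 2 (card G / b) / log 2 R)"
      using ratio \<open>0 \<le> N\<close> by (intro mult_left_mono) auto
    finally show ?thesis
      by simp
  qed
  also have "\<dots> \<le> 2 * N / log 2 R *
      (xlog2 (card G) - xlog2 (card (containing i G)) - xlog2 (card (avoiding i G)))"
    using gain(1,3) K \<open>0 \<le> N\<close> by (intro mult_left_mono) auto
  finally show "\<exists>i\<in>varying G. card (cross_pairs i G) \<le> 2 * N / log 2 R *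
      (xlog2 (card G) - xlog2 (card (containing i G)) - xlog2 (card (avoiding i G)))"
    using i by blast
qed

section \<open>The Kleitman-West graph\<close>

lemma edges_within_double:
  assumes "finite \<A>"
  shows "2 * edges_within n k \<A> \<le> card (adj_pairs \<A>)"
proof -
  define Es where "Es = {E \<in> kw_edges n k. E \<subseteq> \<A>}"
  have "Es \<subseteq> Pow \<A>"
    by (auto simp: Es_def)
  then have "finite Es"
    using assms finite_subset by blast
  have fibre: "card {p \<in> adj_pairs \<A>. {fst p, snd p} = E} = 2" if "E \<in> Es" for E
  proof -
    have "E \<in> kw_edges n k" "E \<subseteq> \<A>"
      using that by (simp_all add: Es_def)
    from this(1) obtain X Y where E: "E = {X, Y}" "card (sym_diff X Y) = 2"
      unfolding kw_edges_def by (elim CollectE exE conjE)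
    with \<open>E \<subseteq> \<A>\<close> have XY: "E = {X, Y}" "card (sym_diff X Y) = 2" "X \<in> \<A>" "Y \<in> \<A>"
      by simp_all
    then have "{p \<in> adj_pairs \<A>. {fst p, snd p} = E} = {(X, Y), (Y, X)}"
      by (auto simp: adj_pairs_def doubleton_eq_iff Un_commute)
    moreover have "X \<noteq> Y"
      using XY by auto
    ultimately show ?thesis
      by simp
  qed
  have "2 * card Es = (\<Sum>E\<in>Es. card {p \<in> adj_pairs \<A>. {fst p, snd p} = E})"
    using fibre by simp
  also have "\<dots> = card (\<Union>E\<in>Es. {p \<in> adj_pairs \<A>. {fst p, snd p} = E})"
    using assms \<open>finite Es\<close> by (intro card_UN_disjoint[symmetric]) auto
  also have "\<dots> \<le> card (adj_pairs \<A>)"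
    using assms by (intro card_mono) auto
  finally show ?thesis
    by (simp add: edges_within_def Es_def)
qed

text \<open>
  The inequality is strict because the empty set is not a member. Strictness makes
  \<open>log n - log log (card \<A>)\<close> positive.
\<close>

lemma card_lt_two_power:
  assumes "0 < k" "\<A> \<subseteq> nsets {1..n} k"
  shows "card \<A> < 2 ^ n"
proof -
  have "\<A> \<subset> Pow {1..n}"
    using assms by (auto simp: nsets_def)
  then have "card \<A> < card (Pow {1..n})"
    by (intro psubset_card_mono) auto
  then show ?thesis
    by (simp add: card_Pow)
qed

theorem theorem11:
  fixes n k :: nat and \<A> :: "nat set set"
  assumes "0 < k" and "k \<le> n"
    and "\<A> \<subseteq> nsets {1..n} k" and "\<A> \<noteq> {}"
  shows "int (edges_within n k \<A>) \<le> int n * ell' n (card \<A>) * int (card \<A>)"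
proof -
  define m where "m = card \<A>"
  define L where "L = log 2 (real m)"
  define e where "e = real (edges_within n k \<A>)"
  have finA: "finite \<A>"
    using assms(3) by (rule finite_subset) (simp add: finite_imp_finite_nsets)
  have "varying \<A> \<subseteq> {1..n}"
    using assms(3) by (auto simp: varying_def nsets_def)
  then have varying: "finite (varying \<A>)" "card (varying \<A>) \<le> n"
    using finite_subset card_mono[of "{1..n}" "varying \<A>"] by auto
  have "m \<noteq> 0"
    using assms(4) finA by (simp add: m_def)
  have double: "2 * e \<le> card (adj_pairs \<A>)"
    using edges_within_double[OF finA, of n k] by (simp add: e_def)
  also have "\<dots> \<le> real (card (varying \<A>)) * (m * L)"
    using card_adj_pairs_le[OF finA varying(1)] by (simp add: xlog2_def m_def L_def)
  also have "\<dots> \<le> n * (m * L)"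
    using varying(2) \<open>m \<noteq> 0\<close> by (intro mult_right_mono) (auto simp: L_def)
  finally have general: "e \<le> n * (L / 2) * m"
    by (simp add: algebra_simps)
  show ?thesis
  proof (cases "m = 1")
    case True
    then have "e \<le> 0"
      using general by (simp add: L_def)
    then show ?thesis
      using True by (simp add: ell'_def m_def e_def)
  next
    case False
    then have "2 \<le> m"
      using \<open>m \<noteq> 0\<close> by simp
    then have "1 \<le> L"
      by (simp add: L_def)
    have "real m < 2 ^ n"
      using card_lt_two_power[OF assms(1,3)] unfolding m_def
      by (metis of_nat_less_iff of_nat_numeral of_nat_power)
    then have "L < n"
      using \<open>m \<noteq> 0\<close> by (simp add: L_def log_less_iff powr_realpow)
    define R where "R = n / L"
    have "1 < R"
      using \<open>L < n\<close> \<open>1 \<le> L\<close> by (simp add: R_def)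
    have logR: "log 2 n - log 2 L = log 2 R"
      using \<open>L < n\<close> \<open>1 \<le> L\<close> by (simp add: R_def log_divide)
    \<comment> \<open>For \<open>R < 4\<close> the denominator \<open>log 2 R\<close> is at most \<open>2\<close>, so \<open>general\<close> suffices.\<close>
    have ratio: "e \<le> n * (L / log 2 R) * m"
    proof (cases "4 \<le> R")
      case True
      have "2 * e \<le> 2 * n / log 2 R * (m * L)"
        using card_adj_pairs_le_small_family[OF finA varying(1), of n R] varying(2) True
          \<open>1 \<le> L\<close> double
        by (simp add: xlog2_def R_def L_def m_def)
      also have "\<dots> = 2 * (n * (L / log 2 R) * m)"
        by simp
      finally show ?thesis
        by simp
    next
      case False
      then have "log 2 R \<le> 2"
        using \<open>1 < R\<close> by (simp add: log_le_iff)
      then have "L / 2 \<le> L / log 2 R"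
        using \<open>1 < R\<close> \<open>1 \<le> L\<close> by (intro divide_left_mono) auto
      then have "n * (L / 2) * m \<le> n * (L / log 2 R) * m"
        by (intro mult_right_mono mult_left_mono) auto
      then show ?thesis
        using general by linarith
    qed
    have bound: "int (edges_within n k \<A>) \<le> int n * l * int m"
      if "e \<le> n * x * m" "x \<le> of_int l" for x :: real and l :: int
    proof -
      have "real n * x * m \<le> real n * real_of_int l * real m"
        using that by (intro mult_right_mono mult_left_mono) auto
      then have "real_of_int (int (edges_within n k \<A>)) \<le> of_int (int n * l * int m)"
        using that by (simp add: e_def)
      then show ?thesis
        by (simp only: of_int_le_iff)
    qed
    have "int (edges_within n k \<A>) \<le> int n * \<lceil>L / log 2 R\<rceil> * int m"
      by (rule bound[OF ratio]) simp
    moreover have "int (edges_within n k \<A>) \<le> int n * \<lfloor>L\<rfloor> * int m"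
    proof (rule bound[OF general])
      \<comment> \<open>Rounding down loses less than a factor of two because \<open>L \<ge> 1\<close>.\<close>
      have "1 \<le> \<lfloor>L\<rfloor>"
        using \<open>1 \<le> L\<close> by simp
      then show "L / 2 \<le> of_int \<lfloor>L\<rfloor>"
        by linarith
    qed
    ultimately show ?thesis
      using False logR by (simp add: ell'_def m_def L_def min_def)
  qed
qed

end
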